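(* Let $X$ and $Y$ be locally convex Hausdorff topological vector spaces and let $F\colon X\rightrightarrows Y$ be a polyhedral convex multifunction. If $C\subset X$ is a generalized polyhedral convex set in $X$, then $F(C)$ is a polyhedral convex set in $Y$. In particular, if $P\subset X$ is a polyhedral convex set in $X$, then $F(P)$ is a polyhedral convex set in $Y$.
   Context: All vector spaces are real. A subset $D$ of a locally convex Hausdorff topological vector space $X$ is a generalized polyhedral convex set if there exist finitely many continuous linear functionals $x_i^*\in X^*$, $\alpha_i\in\mathbb{R}$, $i=1,\dots,m$, and a closed affine subspace $L\subset X$ such that $D=\{x\in X\mid x\in L,\ \langle x_i^*,x\rangle\le\alpha_i,\ i=1,\dots,m\}$; it is a polyhedral convex set if such a representation exists with $L=X$. The empty set counts as polyhedral convex. A multifunction $F\colon X\rightrightarrows Y$ assigns to each $x\in X$ a (possibly empty) subset $F(x)\subset Y$; $\mathrm{gph}\,F=\{(x,y)\in X\times Y\mid y\in F(x)\}$. $F$ is polyhedral convex if $\mathrm{gph}\,F$ is a polyhedral convex set in $X\times Y$. For $C\subset X$, $F(C)=\bigcup_{x\in C}F(x)$. *)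

theory Defs
  imports "HOL-Analysis.Analysis"
begin

text \<open>Convexity is spelled out in the last axiom because \<^const>\<open>convex\<close> is not available inside a
  class specification; lemma \<open>locally_convex\<close> restates the axiom with the constant.\<close>

class locally_convex_hausdorff = real_vector + t2_space + topological_ab_group_add +
  assumes tendsto_scaleR_Pair: "LIM p (nhds r \<times>\<^sub>F nhds x). fst p *\<^sub>R snd p :> nhds (r *\<^sub>R x)"
    and locally_convex_raw: "open U \<Longrightarrow> x \<in> U \<Longrightarrow> \<exists>V. open V \<and>
      (\<forall>y\<in>V. \<forall>z\<in>V. \<forall>u\<ge>0. \<forall>v\<ge>0. u + v = 1 \<longrightarrow> u *\<^sub>R y + v *\<^sub>R z \<in> V) \<and> x \<in> V \<and> V \<subseteq> U"

lemma locally_convex: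
  fixes U :: "'a::locally_convex_hausdorff set"
  assumes "open U" "x \<in> U"
  shows "\<exists>V. open V \<and> convex V \<and> x \<in> V \<and> V \<subseteq> U"
  using locally_convex_raw[OF assms] by (simp add: convex_def)

instance real_normed_vector \<subseteq> locally_convex_hausdorff
proof
  fix r :: real and x :: 'a
  have "((\<lambda>p. fst p *\<^sub>R snd p) \<longlongrightarrow> fst (r, x) *\<^sub>R snd (r, x)) (nhds (r, x))"
    by (intro tendsto_intros filterlim_ident)
  then show "LIM p (nhds r \<times>\<^sub>F nhds x). fst p *\<^sub>R snd p :> nhds (r *\<^sub>R x)"
    by (simp add: nhds_prod)
next
  fix U :: "'a set" and x
  assume "open U" "x \<in> U"
  then obtain e where "e > 0" "ball x e \<subseteq> U"
    by (meson open_contains_ball)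
  then have "\<exists>V. open V \<and> convex V \<and> x \<in> V \<and> V \<subseteq> U"
    by (intro exI[of _ "ball x e"]) auto
  then show "\<exists>V. open V \<and>
      (\<forall>y\<in>V. \<forall>z\<in>V. \<forall>u\<ge>0. \<forall>v\<ge>0. u + v = 1 \<longrightarrow> u *\<^sub>R y + v *\<^sub>R z \<in> V) \<and> x \<in> V \<and> V \<subseteq> U"
    by (simp add: convex_def)
qed

text \<open>The library has the topological group classes on products only for normed spaces.\<close>

instance prod :: (topological_monoid_add, topological_monoid_add) topological_monoid_add
proof
  fix a b :: "'a \<times> 'b"
  have "((\<lambda>p. (fst (fst p) + fst (snd p), snd (fst p) + snd (snd p)))
          \<longlongrightarrow> (fst (fst (a, b)) + fst (snd (a, b)), snd (fst (a, b)) + snd (snd (a, b)))) (nhds (a, b))"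
    by (intro tendsto_intros filterlim_ident)
  then show "LIM p (nhds a \<times>\<^sub>F nhds b). fst p + snd p :> nhds (a + b)"
    by (simp add: nhds_prod plus_prod_def)
qed

instance prod :: (topological_comm_monoid_add, topological_comm_monoid_add) topological_comm_monoid_add ..

instance prod :: (topological_group_add, topological_group_add) topological_group_add
proof
  fix a :: "'a \<times> 'b"
  have "((\<lambda>p. (- fst p, - snd p)) \<longlongrightarrow> (- fst a, - snd a)) (nhds a)"
    by (intro tendsto_intros filterlim_ident)
  then show "(uminus \<longlongrightarrow> - a) (nhds a)"
    by (simp add: uminus_prod_def[abs_def])
qed

instance prod :: (topological_ab_group_add, topological_ab_group_add) topological_ab_group_add ..

instance prod :: (locally_convex_hausdorff, locally_convex_hausdorff) locally_convex_hausdorff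
proof
  fix r :: real and x :: "'a \<times> 'b"
  have *: "((\<lambda>p. f p *\<^sub>R g p) \<longlongrightarrow> c *\<^sub>R z) F"
    if "(f \<longlongrightarrow> c) F" "(g \<longlongrightarrow> z) F" for f and g :: "real \<times> 'a \<times> 'b \<Rightarrow> 'c::locally_convex_hausdorff" and c z F
    using filterlim_compose[OF tendsto_scaleR_Pair, of "\<lambda>p. (f p, g p)" c z F] that
    by (simp add: nhds_prod[symmetric] tendsto_Pair)
  have "((\<lambda>p. (fst p *\<^sub>R fst (snd p), fst p *\<^sub>R snd (snd p)))
          \<longlongrightarrow> (fst (r, x) *\<^sub>R fst (snd (r, x)), fst (r, x) *\<^sub>R snd (snd (r, x)))) (nhds (r, x))"
    by (intro tendsto_Pair * tendsto_fst tendsto_snd filterlim_ident)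
  then show "LIM p (nhds r \<times>\<^sub>F nhds x). fst p *\<^sub>R snd p :> nhds (r *\<^sub>R x)"
    by (simp add: nhds_prod scaleR_prod_def)
next
  fix U :: "('a \<times> 'b) set" and x
  assume "open U" "x \<in> U"
  then obtain A B where AB: "open A" "open B" "x \<in> A \<times> B" "A \<times> B \<subseteq> U"
    by (rule open_prod_elim)
  obtain V where V: "open V" "convex V" "fst x \<in> V" "V \<subseteq> A"
    using locally_convex[of A "fst x"] AB by auto
  obtain W where W: "open W" "convex W" "snd x \<in> W" "W \<subseteq> B"
    using locally_convex[of B "snd x"] AB by auto
  have "\<exists>V. open V \<and> convex V \<and> x \<in> V \<and> V \<subseteq> U"
    using V W AB
    by (intro exI[of _ "V \<times> W"]) (auto simp: mem_Times_iff open_Times convex_Times)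
  then show "\<exists>V. open V \<and>
      (\<forall>y\<in>V. \<forall>z\<in>V. \<forall>u\<ge>0. \<forall>v\<ge>0. u + v = 1 \<longrightarrow> u *\<^sub>R y + v *\<^sub>R z \<in> V) \<and> x \<in> V \<and> V \<subseteq> U"
    by (simp add: convex_def)
qed

text \<open>The number \<open>m\<close> of inequalities may be \<open>0\<close>.\<close>

definition polyhedral_part :: "'a::locally_convex_hausdorff set \<Rightarrow> 'a set \<Rightarrow> bool" where
  "polyhedral_part L D \<longleftrightarrow>
    (\<exists>(m::nat) (f :: nat \<Rightarrow> 'a \<Rightarrow> real) (\<alpha> :: nat \<Rightarrow> real).
      (\<forall>i\<in>{1..m}. linear (f i) \<and> continuous_on UNIV (f i)) \<and>
      D = {x. x \<in> L \<and> (\<forall>i\<in>{1..m}. f i x \<le> \<alpha> i)})"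

text \<open>Since \<^term>\<open>affine {}\<close> holds, \<open>L\<close> may be empty. This adds no new sets \<open>D\<close>: the empty set is
  already given by \<open>L = UNIV\<close> and the single inequality \<open>0 \<le> - 1\<close>.\<close>

definition generalized_polyhedral_convex :: "'a::locally_convex_hausdorff set \<Rightarrow> bool" where
  "generalized_polyhedral_convex D \<longleftrightarrow> (\<exists>L. affine L \<and> closed L \<and> polyhedral_part L D)"

definition polyhedral_convex :: "'a::locally_convex_hausdorff set \<Rightarrow> bool" where
  "polyhedral_convex D \<longleftrightarrow> polyhedral_part UNIV D"

definition gph :: "('a \<Rightarrow> 'b set) \<Rightarrow> ('a \<times> 'b) set" where
  "gph F = {(x, y). y \<in> F x}"

definition polyhedral_convex_multifunction ::
  "('a::locally_convex_hausdorff \<Rightarrow> 'b::locally_convex_hausdorff set) \<Rightarrow> bool" where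
  "polyhedral_convex_multifunction F \<longleftrightarrow> polyhedral_convex (gph F)"

end

theory Submission
  imports Defs
begin

text \<open>
  The whole theorem rests on one fact: the sum \<open>P + M\<close> of a polyhedral convex set \<open>P\<close> and an
  arbitrary linear subspace \<open>M\<close> is again polyhedral convex
  (\<open>polyhedral_convex_plus_subspace\<close>). Indeed, if \<open>C\<close> is cut out of \<open>x\<^sub>0 + M\<close> by finitely many
  inequalities, these inequalities and those of the graph of \<open>F\<close> describe a polyhedral convex set
  \<open>Q\<close> in the product space, and \<open>y\<close> lies in \<open>F(C)\<close> iff \<open>(x\<^sub>0, y)\<close> lies in \<open>Q + M \<times> {0}\<close>. So \<open>F(C)\<close>
  is a slice of a polyhedral convex set.

  That \<open>P + M\<close> is polyhedral convex rests on two observations. The finitely many functionals that define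
  \<open>P\<close> see \<open>M\<close> only through a finite-dimensional image, so some finite \<open>D \<subseteq> M\<close> gives
  \<open>P + M = P + span D\<close> (\<open>finite_representatives_for_functionals\<close>). And adding a single line
  \<open>\<real> d\<close> to \<open>P\<close> is the elimination of one real variable from a finite system of linear
  inequalities, as in Fourier-Motzkin elimination (\<open>polyhedral_convex_plus_line\<close>). The new
  inequalities are nonnegative combinations of the old ones and hence still given by continuous
  functionals. Elimination turns inequalities into inequalities and introduces no equations, so
  the subspace leaves no trace in the description of \<open>F(C)\<close>. This is why the image is polyhedral
  convex and not merely generalized polyhedral convex.
\<close>

section \<open>Polyhedral convex sets as finite intersections of halfspaces\<close>

definition solution_set :: "(('a \<Rightarrow> real) \<times> real) set \<Rightarrow> 'a set" where
  "solution_set S = {x. \<forall>s\<in>S. fst s x \<le> snd s}"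

text \<open>Finite sets of inequalities are easier to combine than the numbered systems of the
  definition.\<close>

lemma polyhedral_convex_iff:
  "polyhedral_convex D \<longleftrightarrow>
    (\<exists>S. finite S \<and> (\<forall>s\<in>S. linear (fst s) \<and> continuous_on UNIV (fst s)) \<and> D = solution_set S)"
  (is "?L \<longleftrightarrow> ?R")
proof
  assume ?L
  then obtain m :: nat and f :: "nat \<Rightarrow> 'a \<Rightarrow> real" and \<alpha>
    where "\<forall>i\<in>{1..m}. linear (f i) \<and> continuous_on UNIV (f i)"
      and "D = {x. x \<in> UNIV \<and> (\<forall>i\<in>{1..m}. f i x \<le> \<alpha> i)}"
    unfolding polyhedral_convex_def polyhedral_part_def by blast
  then show ?R
    by (intro exI[of _ "(\<lambda>i. (f i, \<alpha> i)) ` {1..m}"]) (auto simp: solution_set_def)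
next
  assume ?R
  then obtain S where S: "finite S" "\<forall>s\<in>S. linear (fst s) \<and> continuous_on UNIV (fst s)"
    and D: "D = solution_set S"
    by blast
  obtain h n where h: "S = h ` {1..n::nat}"
    using finite_same_card_bij[of "{1..card S}" S] S(1) by (auto simp: bij_betw_def)
  show ?L
    unfolding polyhedral_convex_def polyhedral_part_def
    by (rule exI[of _ n], rule exI[of _ "fst \<circ> h"], rule exI[of _ "snd \<circ> h"])
      (use S(2) in \<open>simp add: D h solution_set_def\<close>)
qed

lemma polyhedral_convexE:
  assumes "polyhedral_convex D"
  obtains S where "finite S" "\<And>s. s \<in> S \<Longrightarrow> linear (fst s)"
    "\<And>s. s \<in> S \<Longrightarrow> continuous_on UNIV (fst s)" "D = solution_set S"
  using assms unfolding polyhedral_convex_iff by blast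

lemma polyhedral_convexI:
  assumes "finite S" "\<And>s. s \<in> S \<Longrightarrow> linear (fst s)"
    "\<And>s. s \<in> S \<Longrightarrow> continuous_on UNIV (fst s)" "D = solution_set S"
  shows "polyhedral_convex D"
  unfolding polyhedral_convex_iff using assms by (intro exI[of _ S]) auto

lemma polyhedral_convex_halfspace:
  fixes f :: "'a::locally_convex_hausdorff \<Rightarrow> real"
  assumes "linear f" "continuous_on UNIV f"
  shows "polyhedral_convex {x. f x \<le> a}"
  by (rule polyhedral_convexI[of "{(f, a)}"]) (use assms in \<open>auto simp: solution_set_def\<close>)

lemma polyhedral_convex_UNIV: "polyhedral_convex UNIV"
  by (rule polyhedral_convexI[of "{}"]) (auto simp: solution_set_def)

lemma polyhedral_convex_empty: "polyhedral_convex {}"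
  using polyhedral_convex_halfspace[of "\<lambda>_. 0" "-1"] by (simp add: linear_iff)

lemma polyhedral_convex_Int:
  assumes "polyhedral_convex A" "polyhedral_convex B"
  shows "polyhedral_convex (A \<inter> B)"
proof -
  obtain S where S: "finite S" "\<And>s. s \<in> S \<Longrightarrow> linear (fst s)"
    "\<And>s. s \<in> S \<Longrightarrow> continuous_on UNIV (fst s)" "A = solution_set S"
    by (rule polyhedral_convexE[OF assms(1)]) (rule that; blast)
  obtain T where T: "finite T" "\<And>s. s \<in> T \<Longrightarrow> linear (fst s)"
    "\<And>s. s \<in> T \<Longrightarrow> continuous_on UNIV (fst s)" "B = solution_set T"
    by (rule polyhedral_convexE[OF assms(2)]) (rule that; blast)
  show ?thesis
    by (rule polyhedral_convexI[of "S \<union> T"]) (use S T in \<open>auto simp: solution_set_def\<close>)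
qed

lemma polyhedral_convex_INT:
  assumes "finite I" "\<And>i. i \<in> I \<Longrightarrow> polyhedral_convex (A i)"
  shows "polyhedral_convex (\<Inter>i\<in>I. A i)"
  using assms by (induction I) (auto simp: polyhedral_convex_UNIV polyhedral_convex_Int)

text \<open>With \<open>h = fst\<close> this gives cylinders in a product space, with \<open>h y = (0, y)\<close> slices through a
  point \<open>c\<close>.\<close>

lemma polyhedral_convex_affine_vimage:
  assumes h: "linear h" "continuous_on UNIV h" and D: "polyhedral_convex D"
  shows "polyhedral_convex {y. h y + c \<in> D}"
proof -
  obtain S where S: "finite S" "\<And>s. s \<in> S \<Longrightarrow> linear (fst s)"
    "\<And>s. s \<in> S \<Longrightarrow> continuous_on UNIV (fst s)" "D = solution_set S"
    by (rule polyhedral_convexE[OF D]) (rule that; blast)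
  have "h y + c \<in> D \<longleftrightarrow> (\<forall>s\<in>S. fst s (h y) \<le> snd s - fst s c)" for y
    using S(2) by (simp add: S(4) solution_set_def linear_add le_diff_eq)
  then have "{y. h y + c \<in> D} = (\<Inter>s\<in>S. {y. fst s (h y) \<le> snd s - fst s c})"
    by auto
  moreover have "polyhedral_convex {y. fst s (h y) \<le> snd s - fst s c}" if "s \<in> S" for s
  proof (rule polyhedral_convex_halfspace)
    show "linear (\<lambda>y. fst s (h y))"
      using linear_compose[OF h(1) S(2)[OF that]] by (simp add: o_def)
    show "continuous_on UNIV (\<lambda>y. fst s (h y))"
      using continuous_on_compose2[OF S(3)[OF that] h(2)] by simp
  qed
  ultimately show ?thesis
    using polyhedral_convex_INT[OF S(1), of "\<lambda>s. {y. fst s (h y) \<le> snd s - fst s c}"] by simp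
qed

section \<open>Sums with subspaces\<close>

text \<open>The inequalities with \<open>p = 0\<close> do not involve \<open>t\<close>. The others hold iff \<open>t\<close> lies above the lower
  bounds (from \<open>p < 0\<close>) and below the upper bounds (from \<open>p > 0\<close>). As there are finitely many bounds, it
  suffices to compare them pairwise, and clearing denominators makes the comparison linear in
  the constants \<open>r\<close>.\<close>

lemma ex_solution_iff_pairwise:
  fixes r p :: "'i \<Rightarrow> real"
  assumes "finite I"
  shows "(\<exists>t. \<forall>i\<in>I. r i + t * p i \<le> 0) \<longleftrightarrow>
    (\<forall>i\<in>{i\<in>I. p i = 0}. r i \<le> 0) \<and>
    (\<forall>i\<in>{i\<in>I. p i > 0}. \<forall>j\<in>{j\<in>I. p j < 0}. p i * r j - p j * r i \<le> 0)"
  (is "?L \<longleftrightarrow> ?R")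
proof
  assume ?L
  then obtain t where t: "\<And>i. i \<in> I \<Longrightarrow> r i + t * p i \<le> 0"
    by blast
  have "p i * r j - p j * r i \<le> 0" if "i \<in> I" "j \<in> I" "p i > 0" "p j < 0" for i j
  proof -
    have "p i * (r j + t * p j) \<le> 0" "p j * (r i + t * p i) \<ge> 0"
      using that t[of i] t[of j] mult_nonneg_nonpos mult_nonpos_nonpos by (metis less_imp_le)+
    then show ?thesis
      by (simp add: algebra_simps)
  qed
  with t show ?R
    by force
next
  assume R: ?R
  define U where "U = (\<lambda>i. - r i / p i) ` {i\<in>I. p i > 0}"
  define L where "L = (\<lambda>i. - r i / p i) ` {i\<in>I. p i < 0}"
  have fin: "finite U" "finite L"
    using assms by (auto simp: U_def L_def)
  have LU: "l \<le> u" if "l \<in> L" "u \<in> U" for l u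
    using that R by (fastforce simp: U_def L_def field_simps)
  obtain t where t: "\<And>l. l \<in> L \<Longrightarrow> l \<le> t" "\<And>u. u \<in> U \<Longrightarrow> t \<le> u"
  proof (cases "L = {}")
    case True
    show ?thesis
    proof (cases "U = {}")
      case True
      with \<open>L = {}\<close> show ?thesis by (intro that) auto
    next
      case False
      with \<open>L = {}\<close> fin show ?thesis by (intro that[of "Min U"]) auto
    qed
  next
    case False
    with fin LU show ?thesis by (intro that[of "Max L"]) auto
  qed
  have "r i + t * p i \<le> 0" if "i \<in> I" for i
  proof (cases "p i" "0::real" rule: linorder_cases)
    case less
    then have "- r i / p i \<le> t"
      using that by (intro t) (auto simp: L_def)
    with less show ?thesis by (simp add: field_simps)
  next
    case equal
    then show ?thesis using R that by auto
  next
    case greater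
    then have "t \<le> - r i / p i"
      using that by (intro t) (auto simp: U_def)
    with greater show ?thesis by (simp add: field_simps)
  qed
  then show ?L by blast
qed

text \<open>The set below is \<open>P + \<real> d\<close>, in the form that leaves a solvability condition for \<open>t\<close>. Eliminating
  \<open>t\<close> from \<open>f z + t * f d \<le> a\<close> keeps the functionals with \<open>f d = 0\<close> and combines the others in
  pairs with nonnegative weights such that the combination vanishes at \<open>d\<close>.\<close>

lemma polyhedral_convex_plus_line:
  assumes "polyhedral_convex P"
  shows "polyhedral_convex {z. \<exists>t. z + t *\<^sub>R d \<in> P}"
proof -
  obtain S where S: "finite S" "\<And>s. s \<in> S \<Longrightarrow> linear (fst s)"
    "\<And>s. s \<in> S \<Longrightarrow> continuous_on UNIV (fst s)" "P = solution_set S"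
    by (rule polyhedral_convexE[OF assms]) (rule that; blast)
  define Z where "Z = {s\<in>S. fst s d = 0}"
  define U where "U = {s\<in>S. fst s d > 0}"
  define L where "L = {s\<in>S. fst s d < 0}"
  have "z + t *\<^sub>R d \<in> P \<longleftrightarrow> (\<forall>s\<in>S. (fst s z - snd s) + t * fst s d \<le> 0)" for z t
    using S(2) by (auto simp: S(4) solution_set_def linear_add linear_scale algebra_simps)
  then have "{z. \<exists>t. z + t *\<^sub>R d \<in> P} = {z. \<exists>t. \<forall>s\<in>S. (fst s z - snd s) + t * fst s d \<le> 0}"
    by simp
  also have "\<dots> = {z. (\<forall>s\<in>Z. fst s z - snd s \<le> 0) \<and>
      (\<forall>s\<in>U. \<forall>s'\<in>L. fst s d * (fst s' z - snd s') - fst s' d * (fst s z - snd s) \<le> 0)}"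
    unfolding ex_solution_iff_pairwise[OF S(1)] Z_def U_def L_def ..
  also have "\<dots> = (\<Inter>s\<in>Z. {z. fst s z \<le> snd s}) \<inter>
      (\<Inter>s\<in>U. \<Inter>s'\<in>L. {z. fst s d * fst s' z - fst s' d * fst s z \<le> fst s d * snd s' - fst s' d * snd s})"
    by (auto simp: algebra_simps)
  also have "polyhedral_convex \<dots>"
  proof (intro polyhedral_convex_Int polyhedral_convex_INT polyhedral_convex_halfspace)
    show "finite Z" "finite U" "finite L"
      using S(1) by (auto simp: Z_def U_def L_def)
  next
    fix s assume "s \<in> Z"
    then show "linear (fst s)" "continuous_on UNIV (fst s)"
      using S(2,3) by (auto simp: Z_def)
  next
    fix s s' assume "s \<in> U" "s' \<in> L"
    then have "linear (fst s)" "linear (fst s')"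
      "continuous_on UNIV (fst s)" "continuous_on UNIV (fst s')"
      using S(2,3) unfolding U_def L_def by blast+
    then show "linear (\<lambda>z. fst s d * fst s' z - fst s' d * fst s z)"
      "continuous_on UNIV (\<lambda>z. fst s d * fst s' z - fst s' d * fst s z)"
      by (auto intro!: linearI continuous_intros simp: linear_add linear_scale algebra_simps)
  qed
  finally show ?thesis .
qed

lemma polyhedral_convex_plus_span:
  assumes "finite D" "polyhedral_convex P"
  shows "polyhedral_convex {z. \<exists>v\<in>span D. z + v \<in> P}"
  using assms
proof (induction D)
  case empty
  then show ?case by simp
next
  case (insert d D)
  have "{z. \<exists>v\<in>span (insert d D). z + v \<in> P} =
      {z. \<exists>t. z + t *\<^sub>R d \<in> {z. \<exists>v\<in>span D. z + v \<in> P}}" (is "?A = ?B")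
  proof (intro equalityI subsetI)
    fix z assume "z \<in> ?A"
    then obtain v k where "v - k *\<^sub>R d \<in> span D" "z + v \<in> P"
      by (auto simp: span_insert)
    then show "z \<in> ?B"
      by (auto intro!: exI[of _ k] bexI[of _ "v - k *\<^sub>R d"])
  next
    fix z assume "z \<in> ?B"
    then obtain t v where "v \<in> span D" "z + t *\<^sub>R d + v \<in> P"
      by auto
    then show "z \<in> ?A"
      by (auto intro!: exI[of _ "t *\<^sub>R d + v"] exI[of _ t] simp: span_insert add.assoc)
  qed
  then show ?case
    using polyhedral_convex_plus_line[OF insert.IH[OF insert.prems], of d] by simp
qed

text \<open>The joint image of \<open>M\<close> under finitely many functionals is finite-dimensional, so it
  is spanned by the images of finitely many elements of \<open>M\<close>. They are found one functional at a time: a new functional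
  needs a new element only if it does not vanish on the part of \<open>M\<close> annihilated by the previous
  ones.\<close>

lemma finite_representatives_for_functionals:
  fixes M :: "'a::real_vector set" and A :: "('a \<Rightarrow> real) set"
  assumes "finite A" "\<And>f. f \<in> A \<Longrightarrow> linear f" "subspace M"
  obtains D where "finite D" "D \<subseteq> M" "\<And>x. x \<in> M \<Longrightarrow> \<exists>v\<in>span D. \<forall>f\<in>A. f v = f x"
proof -
  have "\<exists>D. finite D \<and> D \<subseteq> M \<and> (\<forall>x\<in>M. \<exists>v\<in>span D. \<forall>f\<in>A. f v = f x)"
    using assms(1,2)
  proof (induction A)
    case empty
    then show ?case by (intro exI[of _ "{}"]) auto
  next
    case (insert g A)
    then obtain D where D: "finite D" "D \<subseteq> M" "\<And>x. x \<in> M \<Longrightarrow> \<exists>v\<in>span D. \<forall>f\<in>A. f v = f x"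
      by blast
    have lin: "linear g" "\<And>f. f \<in> A \<Longrightarrow> linear f"
      using insert.prems by auto
    have spanM: "span D \<subseteq> M"
      using D(2) assms(3) by (rule span_minimal)
    show ?case
    proof (cases "\<forall>z\<in>M. (\<forall>f\<in>A. f z = 0) \<longrightarrow> g z = 0")
      case True
      have "\<exists>v\<in>span D. \<forall>f\<in>insert g A. f v = f x" if x: "x \<in> M" for x
      proof -
        obtain v where v: "v \<in> span D" "\<forall>f\<in>A. f v = f x"
          using D(3)[OF x] by blast
        have "x - v \<in> M"
          using x v(1) spanM assms(3) by (auto intro: subspace_diff)
        moreover have "\<forall>f\<in>A. f (x - v) = 0"
          using v(2) lin(2) by (auto simp: linear_diff)
        ultimately have "g (x - v) = 0"
          using True by blast
        then show ?thesis
          using v lin by (auto simp: linear_diff)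
      qed
      with D show ?thesis by (intro exI[of _ D]) auto
    next
      case False
      then obtain z where z: "z \<in> M" "\<And>f. f \<in> A \<Longrightarrow> f z = 0" "g z \<noteq> 0"
        by blast
      have "\<exists>v\<in>span (insert z D). \<forall>f\<in>insert g A. f v = f x" if x: "x \<in> M" for x
      proof -
        obtain v where v: "v \<in> span D" "\<forall>f\<in>A. f v = f x"
          using D(3)[OF x] by blast
        \<comment> \<open>Moving along \<open>z\<close> corrects the value of \<open>g\<close> and leaves the other values alone.\<close>
        let ?w = "v + ((g x - g v) / g z) *\<^sub>R z"
        have "v \<in> span (insert z D)"
          using span_mono[OF subset_insertI] v(1) by (rule subsetD)
        moreover have "((g x - g v) / g z) *\<^sub>R z \<in> span (insert z D)"
          by (intro span_scale span_base) simp
        ultimately have "?w \<in> span (insert z D)"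
          by (rule span_add)
        moreover have "f ?w = f x" if "f \<in> A" for f
          using v(2) z(2)[OF that] lin(2)[OF that] that by (simp add: linear_add linear_scale)
        moreover have "g ?w = g x"
          using z(3) lin(1) by (simp add: linear_add linear_scale)
        ultimately show ?thesis
          by (intro bexI[of _ ?w]) auto
      qed
      with D(1,2) z(1) show ?thesis
        by (intro exI[of _ "insert z D"]) simp
    qed
  qed
  then show ?thesis
    using that by blast
qed

text \<open>Membership in \<open>P\<close> depends on the values of finitely many functionals only, so the
  subspace may be replaced by the span of finitely many representatives. Since \<open>M = - M\<close>, the
  set below is \<open>P + M\<close>.\<close>

lemma polyhedral_convex_plus_subspace:
  assumes "polyhedral_convex P" "subspace M"
  shows "polyhedral_convex {z. \<exists>v\<in>M. z + v \<in> P}"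
proof -
  obtain S where S: "finite S" "\<And>s. s \<in> S \<Longrightarrow> linear (fst s)"
    "\<And>s. s \<in> S \<Longrightarrow> continuous_on UNIV (fst s)" "P = solution_set S"
    by (rule polyhedral_convexE[OF assms(1)]) (rule that; blast)
  have "finite (fst ` S)" "\<And>f. f \<in> fst ` S \<Longrightarrow> linear f"
    using S(1,2) by auto
  then obtain D where D: "finite D" "D \<subseteq> M" "\<And>x. x \<in> M \<Longrightarrow> \<exists>v\<in>span D. \<forall>f\<in>fst ` S. f v = f x"
    by (rule finite_representatives_for_functionals[OF _ _ assms(2)]) (auto intro: that)
  have same: "z + v \<in> P" if eq: "\<forall>f\<in>fst ` S. f v = f x" and x: "z + x \<in> P" for z v x
  proof -
    have "fst s (z + v) = fst s (z + x)" if "s \<in> S" for s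
      using eq S(2)[OF that] that by (simp add: linear_add)
    then show ?thesis
      using x by (simp add: S(4) solution_set_def)
  qed
  have "span D \<subseteq> M"
    using D(2) assms(2) by (rule span_minimal)
  moreover have "\<exists>v\<in>span D. z + v \<in> P" if "x \<in> M" "z + x \<in> P" for z x
    using D(3)[OF that(1)] same[OF _ that(2)] by (elim bexE) (rule bexI)
  ultimately have "{z. \<exists>v\<in>M. z + v \<in> P} = {z. \<exists>v\<in>span D. z + v \<in> P}"
    by auto
  then show ?thesis
    using polyhedral_convex_plus_span[OF D(1) assms(1)] by simp
qed

section \<open>Images under polyhedral convex multifunctions\<close>

lemma polyhedral_convex_image:
  fixes F :: "'a::locally_convex_hausdorff \<Rightarrow> 'b::locally_convex_hausdorff set"
  assumes F: "polyhedral_convex_multifunction F" and L: "affine L" and C: "polyhedral_part L C"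
  shows "polyhedral_convex (\<Union>x\<in>C. F x)"
proof (cases "L = {}")
  case True
  then have "C = {}"
    using C by (auto simp: polyhedral_part_def)
  then show ?thesis by (simp add: polyhedral_convex_empty)
next
  case False
  then obtain x\<^sub>0 where x\<^sub>0: "x\<^sub>0 \<in> L" by blast
  define M where "M = {x. x\<^sub>0 + x \<in> L}"
  have "subspace M"
  proof -
    have "M = (\<lambda>x. - x\<^sub>0 + x) ` L"
      by (force simp: M_def image_iff)
    then show ?thesis
      using affine_diffs_subspace[OF L x\<^sub>0] by simp
  qed
  then have M: "subspace (M \<times> {0::'b})"
    by (intro subspace_Times) (auto simp: subspace_def)
  obtain C' where C': "polyhedral_convex C'" "C = L \<inter> C'"
    using C unfolding polyhedral_convex_def polyhedral_part_def by blast
  \<comment> \<open>The summand \<open>0\<close> only matches the form of affine preimages.\<close>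
  define Q where "Q = gph F \<inter> {z. fst z + 0 \<in> C'}"
  have "linear (fst :: 'a \<times> 'b \<Rightarrow> 'a)"
    by (auto intro: linearI)
  then have "polyhedral_convex Q"
    unfolding Q_def using F C'(1)
    by (intro polyhedral_convex_Int polyhedral_convex_affine_vimage)
      (auto simp: polyhedral_convex_multifunction_def intro: continuous_intros)
  then have sum: "polyhedral_convex {z. \<exists>v\<in>M \<times> {0}. z + v \<in> Q}"
    using M by (rule polyhedral_convex_plus_subspace)
  have "(\<Union>x\<in>C. F x) = {y. (0, y) + (x\<^sub>0, 0) \<in> {z. \<exists>v\<in>M \<times> {0}. z + v \<in> Q}}" (is "?A = ?B")
  proof (intro equalityI subsetI)
    fix y assume "y \<in> ?A"
    then obtain x where x: "x \<in> L" "x \<in> C'" "y \<in> F x"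
      by (auto simp: C'(2))
    then have "(x - x\<^sub>0, 0) \<in> M \<times> {0}" "(0, y) + (x\<^sub>0, 0) + (x - x\<^sub>0, 0) \<in> Q"
      by (auto simp: M_def Q_def gph_def)
    then show "y \<in> ?B" by blast
  next
    fix y assume "y \<in> ?B"
    then show "y \<in> ?A"
      by (auto simp: M_def Q_def gph_def C'(2))
  qed
  also have "polyhedral_convex \<dots>"
    using sum by (intro polyhedral_convex_affine_vimage) (auto intro!: linearI continuous_intros)
  finally show ?thesis .
qed

theorem proposition3p7:
  fixes F :: "'a::locally_convex_hausdorff \<Rightarrow> 'b::locally_convex_hausdorff set"
  assumes "polyhedral_convex_multifunction F"
  shows "(\<forall>C. generalized_polyhedral_convex C \<longrightarrow> polyhedral_convex (\<Union>x\<in>C. F x)) \<and>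
         (\<forall>P. polyhedral_convex P \<longrightarrow> polyhedral_convex (\<Union>x\<in>P. F x))"
proof (intro conjI allI impI)
  fix C :: "'a set"
  assume "generalized_polyhedral_convex C"
  then show "polyhedral_convex (\<Union>x\<in>C. F x)"
    unfolding generalized_polyhedral_convex_def using polyhedral_convex_image[OF assms] by auto
next
  fix P :: "'a set"
  assume "polyhedral_convex P"
  then show "polyhedral_convex (\<Union>x\<in>P. F x)"
    using polyhedral_convex_image[OF assms affine_UNIV] by (simp add: polyhedral_convex_def)
qed

end
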